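(* Let $p=p(n)\in(0,1)$ satisfy $p(n)\gg 1/n$, i.e. $np(n)\to\infty$ as $n\to\infty$, and let $\mathcal L_n$ be the number of men (equivalently, of women) matched in every stable (possibly partial) matching in the random model with $n$ men, $n$ women, independent uniformly random complete preference lists, and independent admissibility of each pair with probability $p$. Then for every constant $\gamma>2$, $$\mathbb{P}\Bigl(\mathcal L_n\ge n-\frac{\gamma\log(np)}{p}\Bigr)\ge 1-n^{-(1+o(1))(\gamma^2-2\gamma)\log(np)},$$ where $o(1)\to 0$ as $n\to\infty$. Thus, with probability super-polynomially close to $1$, all but at most $\frac{\gamma\log(np)}{p}$ men and at most $\frac{\gamma\log(np)}{p}$ women, i.e. all but $o(n)$ of each, are matched.
   Context: Model. There are $n$ men and $n$ women. Each man has a preference list which is a permutation (strict linear order) of all $n$ women, and each woman has a preference list which is a permutation of all $n$ men; the $2n$ lists are independent and uniformly random. Independently of the lists, each of the $n^2$ pairs (man, woman) is admissible with probability $p=p(n)$, independently of all other pairs. A (possibly partial) matching $M$ is a set of pairwise disjoint admissible pairs (man, woman). It is called stable if there is no admissible pair $(m,w)\notin M$ such that both: $m$ is unmatched in $M$ or prefers $w$ to his partner in $M$; and $w$ is unmatched in $M$ or prefers $m$ to her partner in $M$. A stable matching always exists, and (Gusfield and Irving) all stable matchings of a given instance match the same set of men and the same set of women. $\mathcal L_n$ denotes the common size (number of pairs) of the stable matchings. "Super-polynomially close to $1$" means differing from $1$ by $O(n^{-K})$ for every $K>0$. $\log$ is the natural logarithm. *)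

theory Defs
  imports "HOL-Probability.Probability" "HOL-Combinatorics.Multiset_Permutations"
    "HOL-Library.Landau_Symbols"
begin

(* Men and women are both indexed by {..<n}; a pair (m, w) is always (man, woman).
   P m is the preference list of man m, Q w that of woman w (most preferred first),
   and A (m, w) says that the pair (m, w) is admissible. *)

definition prefers :: "'a list \<Rightarrow> 'a \<Rightarrow> 'a \<Rightarrow> bool" where
  "prefers xs x y \<longleftrightarrow> (\<exists>i j. i < j \<and> j < length xs \<and> xs ! i = x \<and> xs ! j = y)"

definition is_matching :: "nat \<Rightarrow> (nat \<times> nat \<Rightarrow> bool) \<Rightarrow> (nat \<times> nat) set \<Rightarrow> bool" where
  "is_matching n A M \<longleftrightarrow>
     M \<subseteq> {..<n} \<times> {..<n} \<and> (\<forall>e\<in>M. A e) \<and>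
     (\<forall>(m, w)\<in>M. \<forall>(m', w')\<in>M. (m, w) \<noteq> (m', w') \<longrightarrow> m \<noteq> m' \<and> w \<noteq> w')"

definition blocking_pair ::
  "nat \<Rightarrow> (nat \<Rightarrow> nat list) \<Rightarrow> (nat \<Rightarrow> nat list) \<Rightarrow> (nat \<times> nat \<Rightarrow> bool) \<Rightarrow>
   (nat \<times> nat) set \<Rightarrow> nat \<Rightarrow> nat \<Rightarrow> bool" where
  "blocking_pair n P Q A M m w \<longleftrightarrow>
     m < n \<and> w < n \<and> A (m, w) \<and> (m, w) \<notin> M \<and>
     (m \<notin> fst ` M \<or> (\<exists>w'. (m, w') \<in> M \<and> prefers (P m) w w')) \<and>
     (w \<notin> snd ` M \<or> (\<exists>m'. (m', w) \<in> M \<and> prefers (Q w) m m'))"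

definition stable_matching ::
  "nat \<Rightarrow> (nat \<Rightarrow> nat list) \<Rightarrow> (nat \<Rightarrow> nat list) \<Rightarrow> (nat \<times> nat \<Rightarrow> bool) \<Rightarrow>
   (nat \<times> nat) set \<Rightarrow> bool" where
  "stable_matching n P Q A M \<longleftrightarrow>
     is_matching n A M \<and> (\<nexists>m w. blocking_pair n P Q A M m w)"

(* The common size of all stable matchings. It exists whenever the lists are permutations
   of {..<n}: there is a stable matching, and all stable matchings match the same men and
   the same women (Gusfield and Irving). *)
definition stable_size ::
  "nat \<Rightarrow> (nat \<Rightarrow> nat list) \<Rightarrow> (nat \<Rightarrow> nat list) \<Rightarrow> (nat \<times> nat \<Rightarrow> bool) \<Rightarrow> nat" where
  "stable_size n P Q A = (THE l. card ` {M. stable_matching n P Q A M} = {l})"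

definition unmatched_men :: "nat \<Rightarrow> (nat \<times> nat) set \<Rightarrow> nat set" where
  "unmatched_men n M = {..<n} - fst ` M"

definition unmatched_women :: "nat \<Rightarrow> (nat \<times> nat) set \<Rightarrow> nat set" where
  "unmatched_women n M = {..<n} - snd ` M"

definition random_prefs :: "nat \<Rightarrow> (nat \<Rightarrow> nat list) pmf" where
  "random_prefs n = Pi_pmf {..<n} [] (\<lambda>_. pmf_of_set (permutations_of_set {..<n}))"

definition random_admissible :: "nat \<Rightarrow> real \<Rightarrow> (nat \<times> nat \<Rightarrow> bool) pmf" where
  "random_admissible n p = Pi_pmf ({..<n} \<times> {..<n}) False (\<lambda>_. bernoulli_pmf p)"

definition random_market ::
  "nat \<Rightarrow> real \<Rightarrow> ((nat \<Rightarrow> nat list) \<times> (nat \<Rightarrow> nat list) \<times> (nat \<times> nat \<Rightarrow> bool)) pmf" where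
  "random_market n p =
     pair_pmf (random_prefs n) (pair_pmf (random_prefs n) (random_admissible n p))"

end

theory Submission imports Defs begin

text \<open>
  The unmatched men and the unmatched women of a stable matching have no admissible pair between
  them. If more than \<open>t = \<gamma> ln (np) / p\<close> men are unmatched, the admissibility pattern therefore
  contains an all-inadmissible \<open>k \<times> k\<close> rectangle with \<open>k > t\<close>, and the union bound gives at most
  \<open>(n choose k)\<^sup>2 (1 - p) ^ (k\<^sup>2) \<le> exp (- k (p k - 2 - 2 ln (n / k)))\<close>. Here \<open>p k > \<gamma> ln (np)\<close>
  and \<open>1 + ln (n / k) \<le> ln (np)\<close> for large \<open>n\<close>, so the exponent is at most
  \<open>- (\<gamma>\<^sup>2 - 2 \<gamma>) ln (np)\<^sup>2 / p \<le> - (\<gamma>\<^sup>2 - 2 \<gamma>) ln (np) ln n\<close>: the randomness of the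
  preferences plays no role, and the \<open>o(1)\<close> term can be taken to be \<open>0\<close>.
\<close>

section \<open>Comparison within a preference list\<close>

lemma prefers_least_exists:
  assumes "S \<noteq> {}" "S \<subseteq> set xs"
  shows "\<exists>x\<in>S. \<forall>y\<in>S. y \<noteq> x \<longrightarrow> prefers xs x y"
proof -
  define i where "i = (LEAST i. i < length xs \<and> xs ! i \<in> S)"
  have "\<exists>i. i < length xs \<and> xs ! i \<in> S"
    using assms by (metis ex_in_conv in_set_conv_nth subsetD)
  then have i: "i < length xs" "xs ! i \<in> S"
    unfolding i_def by (rule LeastI2_ex, simp)+
  have "prefers xs (xs ! i) y" if y: "y \<in> S" "y \<noteq> xs ! i" for y
  proof -
    obtain j where j: "j < length xs" "xs ! j = y"
      using y assms(2) by (meson in_set_conv_nth subsetD)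
    then have "i \<le> j"
      unfolding i_def using y by (auto intro: Least_le)
    with j y show ?thesis
      unfolding prefers_def by (metis le_neq_implies_less)
  qed
  with i show ?thesis by blast
qed

lemma prefers_total:
  assumes "x \<in> set xs" "y \<in> set xs" "x \<noteq> y"
  shows "prefers xs x y \<or> prefers xs y x"
  using prefers_least_exists[of "{x, y}" xs] assms by auto

text \<open>Distinctness makes positions unique; in a list with repetitions an entry can stand both
  before and after another.\<close>

lemma prefers_asym:
  assumes "distinct xs" "prefers xs x y"
  shows "\<not> prefers xs y x"
  using assms unfolding prefers_def
  by (metis distinct_conv_nth less_trans order_less_asym nth_eq_iff_index_eq)

section \<open>Existence of a stable matching\<close>

text \<open>The complement within \<open>X\<close> is the men's choice from the offers
  \<open>X\<close>. Rejections are recorded rather than choices because they are monotone in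
  \<open>X\<close> (more offers only add rivals), which choices are not.\<close>

definition rejected_by_men ::
  "(nat \<Rightarrow> nat list) \<Rightarrow> (nat \<times> nat) set \<Rightarrow> (nat \<times> nat) set" where
  "rejected_by_men P X = {(m, w) \<in> X. \<exists>w'. (m, w') \<in> X \<and> prefers (P m) w' w}"

definition rejected_by_women ::
  "(nat \<Rightarrow> nat list) \<Rightarrow> (nat \<times> nat) set \<Rightarrow> (nat \<times> nat) set" where
  "rejected_by_women Q X = {(m, w) \<in> X. \<exists>m'. (m', w) \<in> X \<and> prefers (Q w) m' m}"

text \<open>A pair that loses to some offer in \<open>X\<close> also loses to the offer in
  \<open>X\<close> that \<open>m\<close> likes best, and asymmetry keeps that best offer from being
  rejected.\<close>

lemma men_choice:
  assumes P: "P m \<in> permutations_of_set {..<n}" and X: "X \<subseteq> {..<n} \<times> {..<n}"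
    and rej: "(m, w) \<in> rejected_by_men P X"
  obtains w' where "(m, w') \<in> X - rejected_by_men P X" "prefers (P m) w' w"
proof -
  let ?S = "{w. (m, w) \<in> X}"
  have d: "distinct (P m)" and s: "set (P m) = {..<n}"
    using P by (auto simp: permutations_of_set_def)
  from rej obtain w0 where w: "(m, w) \<in> X" "(m, w0) \<in> X" "prefers (P m) w0 w"
    unfolding rejected_by_men_def by auto
  obtain b where b: "(m, b) \<in> X" "\<And>y. (m, y) \<in> X \<Longrightarrow> y \<noteq> b \<Longrightarrow> prefers (P m) b y"
    using prefers_least_exists[of ?S "P m"] w X s by auto
  have "(m, b) \<notin> rejected_by_men P X"
    using b prefers_asym[OF d] unfolding rejected_by_men_def by blast
  moreover have "prefers (P m) b w"
    using w b prefers_asym[OF d] by blast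
  ultimately show ?thesis using b that by blast
qed

text \<open>Exchanging the two sides transports facts about the men's choice to the women.\<close>

lemma rejected_by_women_swap:
  "rejected_by_women Q X = prod.swap ` rejected_by_men Q (prod.swap ` X)"
  unfolding rejected_by_women_def rejected_by_men_def by force

lemma women_choice:
  assumes Q: "Q w \<in> permutations_of_set {..<n}" and X: "X \<subseteq> {..<n} \<times> {..<n}"
    and rej: "(m, w) \<in> rejected_by_women Q X"
  obtains m' where "(m', w) \<in> X - rejected_by_women Q X" "prefers (Q w) m' m"
proof -
  have "(w, m) \<in> rejected_by_men Q (prod.swap ` X)"
    using rej unfolding rejected_by_women_swap by force
  moreover have "prod.swap ` X \<subseteq> {..<n} \<times> {..<n}"
    using X by auto
  ultimately obtain m' where
    "(w, m') \<in> prod.swap ` X - rejected_by_men Q (prod.swap ` X)" "prefers (Q w) m' m"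
    using men_choice[of Q w n "prod.swap ` X" m, OF Q] by blast
  then show ?thesis
    by (intro that[of m']) (force simp: rejected_by_women_swap)+
qed

lemma mono_rejected_by_men: "mono (rejected_by_men P)"
  unfolding mono_def rejected_by_men_def by blast

lemma mono_rejected_by_women: "mono (rejected_by_women Q)"
  unfolding mono_def rejected_by_women_def by blast

text \<open>Fleiner's fixed-point argument: for \<open>X\<close> a fixed point below, the pairs open to the men
  (\<open>X\<close>) and to the women (\<open>Y\<close>) cover all admissible pairs, and \<open>X \<inter> Y\<close> is what either side
  chooses from its own set.\<close>
theorem stable_matching_exists:
  assumes P: "\<And>m. m < n \<Longrightarrow> P m \<in> permutations_of_set {..<n}"
    and Q: "\<And>w. w < n \<Longrightarrow> Q w \<in> permutations_of_set {..<n}"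
  shows "\<exists>M. stable_matching n P Q A M"
proof -
  define E where "E = {e \<in> {..<n} \<times> {..<n}. A e}"
  define X where "X = lfp (\<lambda>X. E - rejected_by_women Q (E - rejected_by_men P X))"
  define Y where "Y = E - rejected_by_men P X"
  define M where "M = X \<inter> Y"
  \<comment> \<open>Each complement in \<open>E\<close> reverses inclusion and each rejection map
    preserves it, so the composition of the two antitone maps is monotone and Knaster-Tarski yields
    a fixed point.\<close>
  have "mono (\<lambda>X. E - rejected_by_women Q (E - rejected_by_men P X))"
    by (intro monoI Diff_mono monoD[OF mono_rejected_by_women] monoD[OF mono_rejected_by_men]) auto
  from lfp_unfold[OF this] have XY: "X = E - rejected_by_women Q Y"
    unfolding X_def Y_def .
  have sub: "rejected_by_men P X \<subseteq> X" "rejected_by_women Q Y \<subseteq> Y"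
    unfolding rejected_by_men_def rejected_by_women_def by auto
  have MX: "M = X - rejected_by_men P X" and MY: "M = Y - rejected_by_women Q Y"
    using XY Y_def sub unfolding M_def by auto
  have XE: "X \<subseteq> E" and YE: "Y \<subseteq> E" and E: "E \<subseteq> {..<n} \<times> {..<n}"
    using XY Y_def E_def by auto
  have XB: "X \<subseteq> {..<n} \<times> {..<n}" and YB: "Y \<subseteq> {..<n} \<times> {..<n}"
    using XE YE E by auto
  have men: "w = w'" if "(m, w) \<in> M" "(m, w') \<in> M" for m w w'
  proof (rule ccontr)
    assume "w \<noteq> w'"
    moreover have "m < n" "w < n" "w' < n" using that XB MX by auto
    ultimately show False
      using that prefers_total[of w "P m" w'] P[of m]
      unfolding MX rejected_by_men_def permutations_of_set_def by auto
  qed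
  have women: "m = m'" if "(m, w) \<in> M" "(m', w) \<in> M" for m m' w
  proof (rule ccontr)
    assume "m \<noteq> m'"
    moreover have "m < n" "m' < n" "w < n" using that XB MX by auto
    ultimately show False
      using that prefers_total[of m "Q w" m'] Q[of w]
      unfolding MY rejected_by_women_def permutations_of_set_def by auto
  qed
  have "is_matching n A M"
    unfolding is_matching_def
  proof (intro conjI)
    show "M \<subseteq> {..<n} \<times> {..<n}" using XB MX by auto
    show "\<forall>e\<in>M. A e" using XE MX E_def by auto
    show "\<forall>(m, w)\<in>M. \<forall>(m', w')\<in>M. (m, w) \<noteq> (m', w') \<longrightarrow> m \<noteq> m' \<and> w \<noteq> w'"
      using men women by blast
  qed
  moreover have "\<not> blocking_pair n P Q A M m w" for m w
  proof
    assume b: "blocking_pair n P Q A M m w"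
    then have mw: "m < n" "w < n" "(m, w) \<in> E" "(m, w) \<notin> M"
      unfolding blocking_pair_def E_def by auto
    have d: "distinct (P m)" "distinct (Q w)"
      using P Q mw by (auto simp: permutations_of_set_def)
    show False
    \<comment> \<open>An admissible pair outside \<open>M\<close> was rejected by one side: by
      \<open>m\<close> from \<open>X\<close> if it lies in \<open>X\<close>, otherwise by
      \<open>w\<close> from \<open>Y\<close>. The rejecting side holds a better partner in
      \<open>M\<close> and so cannot take part in blocking.\<close>
    proof (cases "(m, w) \<in> X")
      case True
      then have "(m, w) \<in> rejected_by_men P X" using mw MX by auto
      then obtain w' where w': "(m, w') \<in> M" "prefers (P m) w' w"
        using men_choice[of P m n X w] P[OF mw(1)] XB MX by metis
      then obtain w'' where "(m, w'') \<in> M" "prefers (P m) w w''"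
        using b unfolding blocking_pair_def by force
      then show False
        using w' men prefers_asym[OF d(1)] by blast
    next
      case False
      then have "(m, w) \<in> rejected_by_women Q Y" using mw XY by auto
      then obtain m' where m': "(m', w) \<in> M" "prefers (Q w) m' m"
        using women_choice[of Q w n Y m] Q[OF mw(2)] YB MY by metis
      then obtain m'' where "(m'', w) \<in> M" "prefers (Q w) m m''"
        using b unfolding blocking_pair_def by force
      then show False
        using m' women prefers_asym[OF d(2)] by blast
    qed
  qed
  ultimately show ?thesis
    unfolding stable_matching_def by blast
qed

section \<open>Invariance of the matched men and of the size\<close>

lemma is_matching_man_unique:
  "is_matching n A M \<Longrightarrow> (m, w) \<in> M \<Longrightarrow> (m, w') \<in> M \<Longrightarrow> w = w'"
  unfolding is_matching_def by blast

lemma is_matching_woman_unique: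
  "is_matching n A M \<Longrightarrow> (m, w) \<in> M \<Longrightarrow> (m', w) \<in> M \<Longrightarrow> m = m'"
  unfolding is_matching_def by blast

text \<open>Let \<open>B\<close> be the men who strictly prefer \<open>M\<close> to \<open>N\<close> and \<open>G\<close> the women who strictly prefer
  \<open>N\<close> to \<open>M\<close>. By stability, \<open>M\<close> maps \<open>B\<close> into \<open>G\<close>, and \<open>N\<close> maps \<open>G\<close> into the members of \<open>B\<close>
  that are matched in \<open>N\<close>; counting shows that all of \<open>B\<close> is matched in \<open>N\<close>.\<close>
lemma stable_matching_matched_men_subset:
  assumes P: "\<And>m. m < n \<Longrightarrow> P m \<in> permutations_of_set {..<n}"
    and Q: "\<And>w. w < n \<Longrightarrow> Q w \<in> permutations_of_set {..<n}"
    and M: "stable_matching n P Q A M" and N: "stable_matching n P Q A N"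
  shows "fst ` M \<subseteq> fst ` N"
proof -
  have mM: "is_matching n A M" and mN: "is_matching n A N"
    using M N unfolding stable_matching_def by auto
  note uM = is_matching_man_unique[OF mM] is_matching_woman_unique[OF mM]
  note uN = is_matching_man_unique[OF mN] is_matching_woman_unique[OF mN]
  define B where "B = {m. \<exists>w. (m, w) \<in> M \<and>
    (m \<notin> fst ` N \<or> (\<exists>w'. (m, w') \<in> N \<and> prefers (P m) w w'))}"
  define G where "G = {w. \<exists>m. (m, w) \<in> N \<and>
    (w \<notin> snd ` M \<or> (\<exists>m'. (m', w) \<in> M \<and> prefers (Q w) m m'))}"
  have bM: "m < n \<and> w < n \<and> A (m, w)" if "(m, w) \<in> M" for m w
    using mM that unfolding is_matching_def by auto
  have bN: "m < n \<and> w < n \<and> A (m, w)" if "(m, w) \<in> N" for m w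
    using mN that unfolding is_matching_def by auto
  have dP: "distinct (P m)" "set (P m) = {..<n}" if "m < n" for m
    using P[OF that] by (auto simp: permutations_of_set_def)
  have dQ: "distinct (Q w)" "set (Q w) = {..<n}" if "w < n" for w
    using Q[OF that] by (auto simp: permutations_of_set_def)
  have finB: "finite B" and finG: "finite G"
    using bM bN by (auto simp: B_def G_def intro!: finite_subset[of _ "{..<n}"])
  have "\<exists>w. (m, w) \<in> M \<and> w \<in> G" if mB: "m \<in> B" for m
  proof -
    obtain w where w: "(m, w) \<in> M" and
      pr: "m \<notin> fst ` N \<or> (\<exists>w'. (m, w') \<in> N \<and> prefers (P m) w w')"
      using mB unfolding B_def by blast
    have mn: "m < n" "w < n" "A (m, w)" using bM w by auto
    have "(m, w) \<notin> N"
      using pr uN(1) prefers_asym[OF dP(1)[OF mn(1)]] by force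
    \<comment> \<open>The man's half of the blocking condition for \<open>N\<close> holds at
      \<open>(m, w)\<close>, so stability of \<open>N\<close> makes the woman's half fail:
      \<open>w\<close> has a partner in \<open>N\<close> to whom she does not prefer
      \<open>m\<close>.\<close>
    with pr mn N have "w \<in> snd ` N \<and> \<not> (\<exists>m'. (m', w) \<in> N \<and> prefers (Q w) m m')"
      unfolding stable_matching_def blocking_pair_def by blast
    then obtain m' where m': "(m', w) \<in> N" "\<not> prefers (Q w) m m'" by force
    then have "prefers (Q w) m' m"
      using prefers_total[of m "Q w" m'] dQ[OF mn(2)] mn bN \<open>(m, w) \<notin> N\<close> by auto
    then show ?thesis
      using w m' unfolding G_def by blast
  qed
  then obtain f where f: "\<And>m. m \<in> B \<Longrightarrow> (m, f m) \<in> M \<and> f m \<in> G" by metis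
  have "card B \<le> card G"
    using f uM(2) finG by (intro card_inj_on_le[of f]) (auto intro!: inj_onI, metis)
  have "\<exists>m. (m, w) \<in> N \<and> m \<in> B" if wG: "w \<in> G" for w
  proof -
    obtain m where m: "(m, w) \<in> N" and
      pr: "w \<notin> snd ` M \<or> (\<exists>m'. (m', w) \<in> M \<and> prefers (Q w) m m')"
      using wG unfolding G_def by blast
    have mn: "m < n" "w < n" "A (m, w)" using bN m by auto
    have "(m, w) \<notin> M"
      using pr uM(2) prefers_asym[OF dQ(1)[OF mn(2)]] by force
    with pr mn M have "m \<in> fst ` M \<and> \<not> (\<exists>w'. (m, w') \<in> M \<and> prefers (P m) w w')"
      unfolding stable_matching_def blocking_pair_def by blast
    then obtain w' where w': "(m, w') \<in> M" "\<not> prefers (P m) w w'" by force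
    then have "prefers (P m) w' w"
      using prefers_total[of w "P m" w'] dP[OF mn(1)] mn bM \<open>(m, w) \<notin> M\<close> by auto
    then show ?thesis
      using m w' unfolding B_def by blast
  qed
  then obtain g where g: "\<And>w. w \<in> G \<Longrightarrow> (g w, w) \<in> N \<and> g w \<in> B" by metis
  have "card G \<le> card (B \<inter> fst ` N)"
    using g uN(1) finB by (intro card_inj_on_le[of g]) (auto intro!: inj_onI rev_image_eqI, metis)
  with \<open>card B \<le> card G\<close> have "B \<inter> fst ` N = B"
    using finB by (intro card_seteq) auto
  \<comment> \<open>A man matched in \<open>M\<close> but not in \<open>N\<close> would lie in
    \<open>B\<close> by the first alternative of its definition, whereas all of \<open>B\<close> is
    now known to be matched in \<open>N\<close>.\<close>
  then show ?thesis
    unfolding B_def by force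
qed

lemma card_matching_men: "is_matching n A M \<Longrightarrow> card (fst ` M) = card M"
  by (intro card_image inj_onI) (auto dest: is_matching_man_unique)

lemma card_matching_women: "is_matching n A M \<Longrightarrow> card (snd ` M) = card M"
  by (intro card_image inj_onI) (auto dest: is_matching_woman_unique)

text \<open>The inclusion of matched men, used in both directions, gives any two stable matchings
  the same men and hence the same number of pairs. The definite description therefore has a unique
  value, readable off any one stable matching.\<close>

lemma stable_size_eq:
  assumes P: "\<And>m. m < n \<Longrightarrow> P m \<in> permutations_of_set {..<n}"
    and Q: "\<And>w. w < n \<Longrightarrow> Q w \<in> permutations_of_set {..<n}"
    and M: "stable_matching n P Q A M"
  shows "stable_size n P Q A = card M"
proof -
  have "card N = card M" if N: "stable_matching n P Q A N" for N
  proof -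
    have "fst ` N = fst ` M"
      using stable_matching_matched_men_subset[of n P Q A M N]
        stable_matching_matched_men_subset[of n P Q A N M] P Q M N by blast
    then show ?thesis
      using M N card_matching_men unfolding stable_matching_def by metis
  qed
  then have "card ` {M. stable_matching n P Q A M} = {card M}"
    using M by blast
  then show ?thesis
    unfolding stable_size_def by auto
qed

lemma card_unmatched:
  assumes "is_matching n A M"
  shows "card (unmatched_men n M) = n - card M" "card (unmatched_women n M) = n - card M"
    "card M \<le> n"
proof -
  have sub: "fst ` M \<subseteq> {..<n}" "snd ` M \<subseteq> {..<n}"
    using assms unfolding is_matching_def by auto
  then show "card (unmatched_men n M) = n - card M" "card (unmatched_women n M) = n - card M"
    unfolding unmatched_men_def unmatched_women_def
    using card_matching_men[OF assms] card_matching_women[OF assms]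
    by (auto simp: card_Diff_subset finite_subset)
  show "card M \<le> n"
    using card_mono[OF _ sub(1)] card_matching_men[OF assms] by simp
qed

section \<open>First moment bound for inadmissible squares\<close>

text \<open>The sides have size exactly \<open>k\<close>: larger inadmissible rectangles contain
  such a square, and the union bound then runs over squares of a single size.\<close>

definition inadmissible_square :: "nat \<Rightarrow> nat \<Rightarrow> (nat \<times> nat \<Rightarrow> bool) \<Rightarrow> bool" where
  "inadmissible_square n k A \<longleftrightarrow>
     (\<exists>S T. S \<subseteq> {..<n} \<and> T \<subseteq> {..<n} \<and> card S = k \<and> card T = k \<and> (\<forall>e\<in>S \<times> T. \<not> A e))"

text \<open>An admissible pair of an unmatched man and an unmatched woman would block
  \<open>M\<close>. Both sides have \<open>n - card M\<close> unmatched members, so any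
  \<open>k\<close> of each span the square.\<close>

lemma stable_matching_inadmissible_square:
  assumes M: "stable_matching n P Q A M" and k: "k \<le> n - card M"
  shows "inadmissible_square n k A"
proof -
  have mM: "is_matching n A M" using M unfolding stable_matching_def by simp
  obtain S where S: "S \<subseteq> unmatched_men n M" "card S = k"
    using obtain_subset_with_card_n k card_unmatched(1)[OF mM] by metis
  obtain T where T: "T \<subseteq> unmatched_women n M" "card T = k"
    using obtain_subset_with_card_n k card_unmatched(2)[OF mM] by metis
  have unm: "\<not> A (m, w)" if "m \<in> unmatched_men n M" "w \<in> unmatched_women n M" for m w
    using M that image_eqI[of m fst "(m, w)" M]
    unfolding stable_matching_def blocking_pair_def unmatched_men_def unmatched_women_def
    by auto
  have "\<forall>e\<in>S \<times> T. \<not> A e"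
    using S(1) T(1) unm by blast
  moreover have "S \<subseteq> {..<n}" "T \<subseteq> {..<n}"
    using S(1) T(1) unfolding unmatched_men_def unmatched_women_def by auto
  ultimately show ?thesis
    using S(2) T(2) unfolding inadmissible_square_def by blast
qed

lemma prob_inadmissible_rectangle:
  assumes "0 \<le> p" "p \<le> 1" "S \<subseteq> {..<n}" "T \<subseteq> {..<n}"
  shows "measure_pmf.prob (random_admissible n p) {A. \<forall>e\<in>S \<times> T. \<not> A e}
    = (1 - p) ^ (card S * card T)"
proof -
  \<comment> \<open>Written as a product set, the event factorises by independence; coordinates
    outside the rectangle are unconstrained and contribute the factor 1.\<close>
  have "{A. \<forall>e\<in>S \<times> T. \<not> A e}
      = Pi ({..<n} \<times> {..<n}) (\<lambda>e. if e \<in> S \<times> T then {False} else UNIV)"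
    using assms by (auto simp: Pi_def split: if_splits)
  also have "measure_pmf.prob (random_admissible n p) \<dots>
      = (\<Prod>e\<in>{..<n} \<times> {..<n}. measure_pmf.prob (bernoulli_pmf p)
            (if e \<in> S \<times> T then {False} else UNIV))"
    unfolding random_admissible_def by (rule measure_Pi_pmf_Pi) auto
  also have "\<dots> = (\<Prod>e\<in>S \<times> T. 1 - p)"
    using assms by (intro prod.mono_neutral_cong_right)
      (auto simp: measure_pmf_single simp flip: measure_pmf.prob_space)
  finally show ?thesis by (simp add: card_cartesian_product)
qed

lemma prob_inadmissible_square_le:
  assumes "0 \<le> p" "p \<le> 1"
  shows "measure_pmf.prob (random_admissible n p) {A. inadmissible_square n k A}
    \<le> real (n choose k) ^ 2 * (1 - p) ^ (k * k)"
proof -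
  let ?F = "{S. S \<subseteq> {..<n} \<and> card S = k}"
  let ?pr = "measure_pmf.prob (random_admissible n p)"
  have fin: "finite ?F" by auto
  have card: "card ?F = n choose k" by (simp add: n_subsets)
  have "{A. inadmissible_square n k A}
      = (\<Union>(S, T)\<in>?F \<times> ?F. {A. \<forall>e\<in>S \<times> T. \<not> A e})"
    unfolding inadmissible_square_def by auto
  also have "?pr \<dots> \<le> (\<Sum>x\<in>?F \<times> ?F. ?pr (case x of (S, T) \<Rightarrow> {A. \<forall>e\<in>S \<times> T. \<not> A e}))"
    using fin by (intro measure_pmf.finite_measure_subadditive_finite) auto
  also have "\<dots> = (\<Sum>x\<in>?F \<times> ?F. (1 - p) ^ (k * k))"
    using prob_inadmissible_rectangle[OF assms] by (intro sum.cong) auto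
  finally show ?thesis
    by (simp add: card card_cartesian_product power2_eq_square)
qed

text \<open>Combines \<open>n choose k \<le> n ^ k / fact k\<close> with
  \<open>k ^ k / fact k \<le> exp k\<close>; the latter holds because the left side is a single term
  of the exponential series at \<open>k\<close>.\<close>

lemma choose_le_power:
  assumes "k \<ge> 1"
  shows "real (n choose k) \<le> (exp 1 * real n / real k) ^ k"
proof -
  have *: "real k ^ k / fact k \<le> exp (real k)"
  proof -
    have "(\<Sum>i\<in>{k}. real k ^ i /\<^sub>R fact i) \<le> exp (real k)"
      unfolding exp_def by (intro sum_le_suminf summable_exp_generic) auto
    then show ?thesis by (simp add: divide_inverse mult.commute)
  qed
  have "real (n choose k) * fact k \<le> real n ^ k"
    using binomial_fact_pow[of n k] by (metis of_nat_fact of_nat_le_iff of_nat_mult of_nat_power)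
  then have "real (n choose k) \<le> real n ^ k / fact k"
    by (simp add: field_simps)
  also have "\<dots> \<le> real n ^ k * (exp (real k) / real k ^ k)"
    using mult_left_mono[OF *, of "real n ^ k"] assms by (simp add: field_simps)
  also have "\<dots> = (exp 1 * real n / real k) ^ k"
    by (simp add: power_divide power_mult_distrib exp_of_nat_mult[symmetric])
  finally show ?thesis .
qed

lemma first_moment_bound:
  fixes p \<gamma> :: real
  assumes p: "0 < p" "p < 1" and gamma: "\<gamma> > 2" and large: "ln (real n * p) \<ge> 2"
    and n: "n \<ge> 1"
  defines "t \<equiv> \<gamma> * ln (real n * p) / p"
  assumes k: "real k > t"
  shows "real (n choose k) ^ 2 * (1 - p) ^ (k * k)
    \<le> real n powr (- ((\<gamma>\<^sup>2 - 2 * \<gamma>) * ln (real n * p)))"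
proof -
  define L where "L = ln (real n * p)"
  have L: "L \<ge> 2" using large L_def by simp
  have tpos: "t > 0" using p gamma L by (simp add: t_def L_def[symmetric])
  have kpos: "real k > 0" "k \<ge> 1" using k tpos by auto
  have npos: "real n > 0" using n by simp
  \<comment> \<open>Since \<open>ln n = L + ln (1 / p)\<close>, this amounts to
    \<open>p * ln (1 / p) \<le> (1 - p) * L\<close>, which follows from
    \<open>ln x \<le> x - 1\<close> at \<open>x = 1 / p\<close> and \<open>L \<ge> 1\<close>. It
    converts the factor \<open>1 / p\<close> of the exponent into \<open>ln n\<close>, and so the
    bound into a power of \<open>n\<close>.\<close>
  have Lp: "L / p \<ge> ln (real n)"
  proof -
    have "ln (1 / p) \<le> 1 / p - 1" using p by (intro ln_le_minus_one) auto
    then have "p * ln (1 / p) \<le> 1 - p" using p by (simp add: field_simps)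
    moreover have "ln (1 / p) \<ge> 0" using p by (simp add: ln_div)
    moreover have "ln (real n) = L + ln (1 / p)"
      using p npos by (simp add: L_def ln_mult ln_div)
    moreover have "1 - p \<le> (1 - p) * L"
      using L p by (simp add: mult_le_cancel_left1)
    ultimately have "p * ln (real n) \<le> L" by (simp add: algebra_simps)
    then show ?thesis using p by (simp add: field_simps)
  qed
  \<comment> \<open>From \<open>\<gamma> * L \<ge> 4 > exp 1\<close> one gets
    \<open>k \<ge> exp 1 / p\<close>, that is \<open>n / k \<le> n * p / exp 1\<close>. The gain of
    1 cancels the factor \<open>exp 1\<close> in the binomial estimate.\<close>
  have a: "ln (real n / real k) \<le> L - 1"
  proof -
    have "t \<ge> exp 1 / p"
      using exp_le mult_mono[of 2 \<gamma> 2 L] p gamma L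
      by (auto simp: t_def L_def[symmetric] intro!: divide_right_mono)
    then have "exp 1 / p \<le> real k" using k by simp
    then have "real n / real k \<le> real n * p / exp 1"
      using p npos kpos by (simp add: field_simps)
    then have "ln (real n / real k) \<le> ln (real n * p / exp 1)"
      using npos kpos p by (subst ln_le_cancel_iff) auto
    also have "\<dots> = L - 1"
      using npos p by (simp add: L_def ln_div)
    finally show ?thesis .
  qed
  have "real (n choose k) ^ 2 * (1 - p) ^ (k * k)
      \<le> ((exp 1 * real n / real k) ^ k) ^ 2 * (exp (- p)) ^ (k * k)"
    using p exp_ge_add_one_self[of "- p"] choose_le_power[OF kpos(2)]
    by (intro mult_mono power_mono) auto
  also have "\<dots> = exp (2 * real k * (1 + ln (real n / real k)) - p * real k * real k)"
  proof -
    have "exp 1 * real n / real k = exp (1 + ln (real n / real k))"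
      using npos kpos by (simp add: exp_add)
    then show ?thesis
      by (simp add: exp_of_nat_mult[symmetric] mult_exp_exp power_mult[symmetric] algebra_simps)
  qed
  also have "\<dots> \<le> exp (- ((\<gamma>\<^sup>2 - 2 * \<gamma>) * L * (L / p)))"
  proof -
    have kL: "real k > \<gamma> * L / p"
      using k unfolding t_def L_def .
    then have "p * real k \<ge> \<gamma> * L"
      using p by (simp add: field_simps)
    then have "p * real k - 2 * (1 + ln (real n / real k)) \<ge> (\<gamma> - 2) * L"
      using a by (simp add: algebra_simps)
    moreover have "real k \<ge> \<gamma> * L / p"
      using kL by simp
    \<comment> \<open>The lower bounds for the two factors of the exponent may be multiplied because
      \<open>(\<gamma> - 2) * L\<close> is nonnegative, by \<open>\<gamma> > 2\<close>; their
      product carries the constant \<open>\<gamma> * (\<gamma> - 2)\<close>.\<close>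
    ultimately have "(\<gamma> * L / p) * ((\<gamma> - 2) * L)
        \<le> real k * (p * real k - 2 * (1 + ln (real n / real k)))"
      using gamma L p by (intro mult_mono) auto
    then show ?thesis by (simp add: algebra_simps power2_eq_square)
  qed
  also have "\<dots> \<le> exp (- ((\<gamma>\<^sup>2 - 2 * \<gamma>) * L * ln (real n)))"
  proof -
    have "\<gamma>\<^sup>2 - 2 * \<gamma> \<ge> 0" using gamma by (simp add: power2_eq_square)
    then show ?thesis
      using mult_left_mono[OF Lp, of "(\<gamma>\<^sup>2 - 2 * \<gamma>) * L"] L by simp
  qed
  finally show ?thesis
    using npos by (simp add: powr_def L_def)
qed

section \<open>Failure probabilities in the random market\<close>

text \<open>Almost surely all lists are permutations, so failure of \<open>E\<close> is almost
  surely contained in an event about admissibility alone, whose law is the third marginal of the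
  market. \<open>E\<close> stays arbitrary because two different events are treated this
  way.\<close>

lemma prob_market_le:
  assumes "0 \<le> p" "p \<le> 1"
    and bad: "\<And>P Q A. (\<And>m. m < n \<Longrightarrow> P m \<in> permutations_of_set {..<n}) \<Longrightarrow>
      (\<And>w. w < n \<Longrightarrow> Q w \<in> permutations_of_set {..<n}) \<Longrightarrow>
      (P, Q, A) \<notin> E \<Longrightarrow> inadmissible_square n k A"
  shows "1 - measure_pmf.prob (random_market n p) E
    \<le> real (n choose k) ^ 2 * (1 - p) ^ (k * k)"
proof -
  let ?R = "random_market n p"
  have prefs: "P m \<in> permutations_of_set {..<n}"
    if "P \<in> set_pmf (random_prefs n)" "m < n" for P m
    using that unfolding random_prefs_def
    by (subst (asm) set_Pi_pmf)
       (auto simp: PiE_dflt_def)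
  have "1 - measure_pmf.prob ?R E = measure_pmf.prob ?R (- E)"
    using measure_pmf.prob_compl[of E ?R] by (simp add: Compl_eq_Diff_UNIV)
  also have "\<dots> \<le> measure_pmf.prob ?R ((snd \<circ> snd) -` {A. inadmissible_square n k A})"
  proof (rule measure_pmf.finite_measure_mono_AE)
    have "inadmissible_square n k A" if "(P, Q, A) \<in> set_pmf ?R" "(P, Q, A) \<notin> E" for P Q A
    proof -
      from that(1) have "P \<in> set_pmf (random_prefs n)" "Q \<in> set_pmf (random_prefs n)"
        unfolding random_market_def by simp_all
      with bad[of P Q A] prefs that(2) show ?thesis by blast
    qed
    then show "AE x in ?R. x \<in> - E \<longrightarrow> x \<in> (snd \<circ> snd) -` {A. inadmissible_square n k A}"
      unfolding AE_measure_pmf_iff by auto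
  qed auto
  also have "\<dots> = measure_pmf.prob (map_pmf (snd \<circ> snd) ?R) {A. inadmissible_square n k A}"
    by simp
  also have "map_pmf (snd \<circ> snd) ?R = random_admissible n p"
    unfolding random_market_def by (simp add: pmf.map_comp[symmetric] map_snd_pair_pmf)
  also have "measure_pmf.prob \<dots> {A. inadmissible_square n k A}
      \<le> real (n choose k) ^ 2 * (1 - p) ^ (k * k)"
    using assms by (intro prob_inadmissible_square_le)
  finally show ?thesis .
qed

theorem theorem1p3:
  fixes p :: "nat \<Rightarrow> real" and \<gamma> :: real
  assumes p01: "\<And>n. n \<ge> 1 \<Longrightarrow> 0 < p n \<and> p n < 1"
    and np: "filterlim (\<lambda>n. real n * p n) at_top sequentially"
    and gamma: "\<gamma> > 2"
  shows
    "(\<exists>\<epsilon> :: nat \<Rightarrow> real. \<epsilon> \<longlonglongrightarrow> 0 \<and>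
        (\<forall>\<^sub>F n in sequentially.
           measure_pmf.prob (random_market n (p n))
             {(P, Q, A). real (stable_size n P Q A) \<ge> real n - \<gamma> * ln (real n * p n) / p n}
           \<ge> 1 - real n powr (- ((1 + \<epsilon> n) * (\<gamma>\<^sup>2 - 2 * \<gamma>) * ln (real n * p n)))))
     \<and> (\<forall>K > 0.
          (\<lambda>n. 1 - measure_pmf.prob (random_market n (p n))
             {(P, Q, A). \<forall>M. stable_matching n P Q A M \<longrightarrow>
                real (card (unmatched_men n M)) \<le> \<gamma> * ln (real n * p n) / p n \<and>
                real (card (unmatched_women n M)) \<le> \<gamma> * ln (real n * p n) / p n})
          \<in> O(\<lambda>n. real n powr (- K)))
     \<and> (\<lambda>n. \<gamma> * ln (real n * p n) / p n) \<in> o(\<lambda>n. real n)"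
proof -
  let ?t = "\<lambda>n. \<gamma> * ln (real n * p n) / p n"
  \<comment> \<open>The least natural number strictly above \<open>?t n\<close> when
    \<open>?t n\<close> is nonnegative, so a count exceeding \<open>?t n\<close> is at least
    \<open>k n\<close>. For negative \<open>?t n\<close>, \<open>nat\<close> makes it 1.\<close>
  define k where "k n = Suc (nat \<lfloor>?t n\<rfloor>)" for n
  have lnp: "filterlim (\<lambda>n. ln (real n * p n)) at_top sequentially"
    using np by (rule filterlim_compose[OF ln_at_top])
  then have large: "\<forall>\<^sub>F n in sequentially. ln (real n * p n) \<ge> 2"
    by (simp add: filterlim_at_top)
  have kt: "real (k n) > ?t n" for n
    unfolding k_def by linarith
  have k_le: "k n \<le> d" if "real d > ?t n" "ln (real n * p n) \<ge> 2" "n \<ge> 1" for d n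
  proof -
    have "?t n \<ge> 0" using that(2) p01[OF that(3)] gamma
      by (intro divide_nonneg_pos mult_nonneg_nonneg) linarith+
    with that(1) show ?thesis unfolding k_def by linarith
  qed
  \<comment> \<open>A single estimate for both events below: outside \<open>E\<close> it suffices to
    exhibit one stable matching with more than \<open>?t n\<close> unmatched men.\<close>
  have tail: "\<forall>\<^sub>F n in sequentially. \<forall>E.
      (\<forall>P Q A. (\<forall>m<n. P m \<in> permutations_of_set {..<n}) \<longrightarrow>
         (\<forall>w<n. Q w \<in> permutations_of_set {..<n}) \<longrightarrow> (P, Q, A) \<notin> E \<longrightarrow>
         (\<exists>M. stable_matching n P Q A M \<and> real (n - card M) > ?t n)) \<longrightarrow>
      1 - measure_pmf.prob (random_market n (p n)) E
        \<le> real n powr (- ((\<gamma>\<^sup>2 - 2 * \<gamma>) * ln (real n * p n)))"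
    using large eventually_ge_at_top[of 1]
  proof eventually_elim
    case (elim n)
    note pn = p01[OF elim(2)]
    show ?case
    proof (intro allI impI)
      fix E
      assume E: "\<forall>P Q A. (\<forall>m<n. P m \<in> permutations_of_set {..<n}) \<longrightarrow>
         (\<forall>w<n. Q w \<in> permutations_of_set {..<n}) \<longrightarrow> (P, Q, A) \<notin> E \<longrightarrow>
         (\<exists>M. stable_matching n P Q A M \<and> real (n - card M) > ?t n)"
      have "1 - measure_pmf.prob (random_market n (p n)) E
        \<le> real (n choose k n) ^ 2 * (1 - p n) ^ (k n * k n)"
      proof (rule prob_market_le)
        fix P Q A
        assume "\<And>m. m < n \<Longrightarrow> P m \<in> permutations_of_set {..<n}"
          and "\<And>w. w < n \<Longrightarrow> Q w \<in> permutations_of_set {..<n}" and "(P, Q, A) \<notin> E"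
        then obtain M where M: "stable_matching n P Q A M" "real (n - card M) > ?t n"
          using E by blast
        show "inadmissible_square n (k n) A"
          using stable_matching_inadmissible_square[OF M(1) k_le[OF M(2) elim]] .
      qed (use pn in auto)
      also have "\<dots> \<le> real n powr (- ((\<gamma>\<^sup>2 - 2 * \<gamma>) * ln (real n * p n)))"
        using pn gamma elim kt by (intro first_moment_bound) auto
      finally show "1 - measure_pmf.prob (random_market n (p n)) E
        \<le> real n powr (- ((\<gamma>\<^sup>2 - 2 * \<gamma>) * ln (real n * p n)))" .
    qed
  qed
  have size: "\<forall>\<^sub>F n in sequentially.
      1 - measure_pmf.prob (random_market n (p n))
        {(P, Q, A). real (stable_size n P Q A) \<ge> real n - ?t n}
      \<le> real n powr (- ((\<gamma>\<^sup>2 - 2 * \<gamma>) * ln (real n * p n)))"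
    using tail
  proof (rule eventually_mono, elim allE impE)
    fix n
    show "\<forall>P Q A. (\<forall>m<n. P m \<in> permutations_of_set {..<n}) \<longrightarrow>
        (\<forall>w<n. Q w \<in> permutations_of_set {..<n}) \<longrightarrow>
        (P, Q, A) \<notin> {(P, Q, A). real (stable_size n P Q A) \<ge> real n - ?t n} \<longrightarrow>
        (\<exists>M. stable_matching n P Q A M \<and> real (n - card M) > ?t n)"
    proof (intro allI impI)
      fix P Q A
      assume P: "\<forall>m<n. P m \<in> permutations_of_set {..<n}"
        and Q: "\<forall>w<n. Q w \<in> permutations_of_set {..<n}"
        and small: "(P, Q, A) \<notin> {(P, Q, A). real (stable_size n P Q A) \<ge> real n - ?t n}"
      \<comment> \<open>Existence enters here: \<open>stable_size\<close> equals
        \<open>card M\<close> only once some stable \<open>M\<close> is at hand. For the event about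
        unmatched men and women, its failure supplies \<open>M\<close> directly.\<close>
      obtain M where M: "stable_matching n P Q A M"
        using stable_matching_exists[of n P Q A] P Q by auto
      \<comment> \<open>Ensures that the truncated subtraction in \<open>n - card M\<close> agrees
        with subtraction of reals.\<close>
      then have "card M \<le> n"
        using card_unmatched(3) unfolding stable_matching_def by blast
      moreover have "real (card M) < real n - ?t n"
        using small stable_size_eq[of n P Q A M] P Q M by auto
      ultimately show "\<exists>M. stable_matching n P Q A M \<and> real (n - card M) > ?t n"
        using M by (intro exI[of _ M]) (auto simp: of_nat_diff)
    qed
  qed
  have unmatched: "\<forall>\<^sub>F n in sequentially.
      1 - measure_pmf.prob (random_market n (p n))
        {(P, Q, A). \<forall>M. stable_matching n P Q A M \<longrightarrow>
           real (card (unmatched_men n M)) \<le> ?t n \<and> real (card (unmatched_women n M)) \<le> ?t n}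
      \<le> real n powr (- ((\<gamma>\<^sup>2 - 2 * \<gamma>) * ln (real n * p n)))"
    using tail
  proof (rule eventually_mono, elim allE impE)
    fix n
    show "\<forall>P Q A. (\<forall>m<n. P m \<in> permutations_of_set {..<n}) \<longrightarrow>
        (\<forall>w<n. Q w \<in> permutations_of_set {..<n}) \<longrightarrow>
        (P, Q, A) \<notin> {(P, Q, A). \<forall>M. stable_matching n P Q A M \<longrightarrow>
           real (card (unmatched_men n M)) \<le> ?t n \<and> real (card (unmatched_women n M)) \<le> ?t n} \<longrightarrow>
        (\<exists>M. stable_matching n P Q A M \<and> real (n - card M) > ?t n)"
    proof (intro allI impI)
      fix P Q A
      assume "(P, Q, A) \<notin> {(P, Q, A). \<forall>M. stable_matching n P Q A M \<longrightarrow>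
           real (card (unmatched_men n M)) \<le> ?t n \<and> real (card (unmatched_women n M)) \<le> ?t n}"
      then obtain M where M: "stable_matching n P Q A M" and
        "\<not> (real (card (unmatched_men n M)) \<le> ?t n \<and> real (card (unmatched_women n M)) \<le> ?t n)"
        by auto
      moreover have "card (unmatched_men n M) = n - card M" "card (unmatched_women n M) = n - card M"
        using M card_unmatched unfolding stable_matching_def by blast+
      ultimately show "\<exists>M. stable_matching n P Q A M \<and> real (n - card M) > ?t n"
        by (intro exI[of _ M]) auto
    qed
  qed
  have gg: "\<gamma>\<^sup>2 - 2 * \<gamma> > 0" using gamma by (simp add: power2_eq_square)
  show ?thesis
  proof (intro conjI allI impI)
    show "\<exists>\<epsilon> :: nat \<Rightarrow> real. \<epsilon> \<longlonglongrightarrow> 0 \<and>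
        (\<forall>\<^sub>F n in sequentially.
           measure_pmf.prob (random_market n (p n))
             {(P, Q, A). real (stable_size n P Q A) \<ge> real n - \<gamma> * ln (real n * p n) / p n}
           \<ge> 1 - real n powr (- ((1 + \<epsilon> n) * (\<gamma>\<^sup>2 - 2 * \<gamma>) * ln (real n * p n))))"
      using size by (intro exI[of _ "\<lambda>_. 0"]) (auto elim!: eventually_mono)
  next
    fix K :: real
    assume "K > 0"
    \<comment> \<open>The exponent is a positive multiple of \<open>ln (n * p n)\<close>, which
      tends to infinity and so eventually exceeds any fixed \<open>K\<close>; this is the
      super-polynomial decay.\<close>
    have "\<forall>\<^sub>F n in sequentially. ln (real n * p n) \<ge> K / (\<gamma>\<^sup>2 - 2 * \<gamma>)"
      using lnp by (simp add: filterlim_at_top)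
    with unmatched eventually_ge_at_top[of 1]
    have "\<forall>\<^sub>F n in sequentially.
      norm (1 - measure_pmf.prob (random_market n (p n))
        {(P, Q, A). \<forall>M. stable_matching n P Q A M \<longrightarrow>
           real (card (unmatched_men n M)) \<le> ?t n \<and> real (card (unmatched_women n M)) \<le> ?t n})
      \<le> 1 * norm (real n powr (- K))"
    proof eventually_elim
      case (elim n)
      have "K \<le> (\<gamma>\<^sup>2 - 2 * \<gamma>) * ln (real n * p n)"
        using elim(3) gg by (simp add: field_simps)
      then have "real n powr (- ((\<gamma>\<^sup>2 - 2 * \<gamma>) * ln (real n * p n))) \<le> real n powr (- K)"
        using elim(2) by (intro powr_mono) auto
      with elim(1) show ?case by simp
    qed
    then show "(\<lambda>n. 1 - measure_pmf.prob (random_market n (p n))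
             {(P, Q, A). \<forall>M. stable_matching n P Q A M \<longrightarrow>
                real (card (unmatched_men n M)) \<le> \<gamma> * ln (real n * p n) / p n \<and>
                real (card (unmatched_women n M)) \<le> \<gamma> * ln (real n * p n) / p n})
          \<in> O(\<lambda>n. real n powr (- K))"
      by (rule bigoI)
  next
    \<comment> \<open>Used along \<open>x = n * p n\<close>, since \<open>?t n / n\<close> is
      \<open>\<gamma>\<close> times \<open>ln x / x\<close> there.\<close>
    have "((\<lambda>x::real. ln x / x) \<longlongrightarrow> 0) at_top"
      by (rule ln_x_over_x_tendsto_0)
    then have "(\<lambda>n. ln (real n * p n) / (real n * p n)) \<longlonglongrightarrow> 0"
      using np by (rule filterlim_compose)
    then have "(\<lambda>n. \<gamma> * (ln (real n * p n) / (real n * p n))) \<longlonglongrightarrow> 0"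
      by (rule tendsto_mult_right_zero)
    then have "(\<lambda>n. ?t n / real n) \<longlonglongrightarrow> 0"
      by (simp add: field_simps)
    then show "?t \<in> o(\<lambda>n. real n)"
      by (intro smalloI_tendsto eventually_mono[OF eventually_gt_at_top[of 0]]) auto
  qed
qed

end
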